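(* For every $n\in\mathbb{N}$ we have $$\sum_{w\in B_n}X^{(\sigma-l)(w)}\,Y^{\mathrm{neg}(w)}\,Z^{\mathrm{rmaj}(w)}=\prod_{i=0}^{n-1}\frac{(1+X^iYZ)\,(1-(X^{n+i}Z)^{n-i})}{1-X^{n+i}Z}.$$
   Context: $X,Y,Z$ are indeterminates. $B_n$ is the group of bijections $w$ of $\{-n,\dots,n\}$ with $w(-i)=-w(i)$ for all $i$ (the hyperoctahedral group). Its standard Coxeter generators are $s_0,\dots,s_{n-1}$, where $s_0$ sends $1\mapsto-1$ and fixes $2,\dots,n$, and for $1\le i\le n-1$, $s_i$ exchanges $i$ and $i+1$ and fixes the other elements of $\{1,\dots,n\}$. $l$ is the Coxeter length with respect to these generators, $D(w)=\{i\in\{0,\dots,n-1\}\mid l(ws_i)<l(w)\}$ is the right descent set, $\mathrm{neg}(w)=\#\{i\in\{1,\dots,n\}\mid w(i)<0\}$, $\sigma(w)=\sum_{i\in D(w)}(n^2-i^2)$, and $\mathrm{rmaj}(w)=\sum_{i\in D(w)}(n-i)$. *)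

theory Defs
  imports
    "HOL-Combinatorics.Permutations"
    "HOL-Computational_Algebra.Polynomial_Factorial"
begin

text \<open>
  An element of $B_n$ is encoded as a function on all integers that is the identity outside
  $\{-n,\dots,n\}$; the group operation is composition of functions.
\<close>

definition hyperoctahedral :: "nat \<Rightarrow> (int \<Rightarrow> int) set" where
  "hyperoctahedral n = {w. w permutes {- int n..int n} \<and> (\<forall>i. w (- i) = - w i)}"

definition cox_gen :: "nat \<Rightarrow> int \<Rightarrow> int" where
  "cox_gen i =
     (if i = 0 then transpose 1 (- 1)
      else transpose (int i) (int i + 1) \<circ> transpose (- int i) (- (int i + 1)))"

definition word_prod :: "nat list \<Rightarrow> int \<Rightarrow> int" where
  "word_prod is = foldr (\<lambda>i w. cox_gen i \<circ> w) is id"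

text \<open>
  The least element below exists for every element of $B_n$, since the generators
  $s_0,\dots,s_{n-1}$ generate $B_n$; the value at other functions is irrelevant.
\<close>

definition cox_length :: "nat \<Rightarrow> (int \<Rightarrow> int) \<Rightarrow> nat" where
  "cox_length n w = (LEAST k. \<exists>is. length is = k \<and> set is \<subseteq> {..<n} \<and> word_prod is = w)"

definition descents :: "nat \<Rightarrow> (int \<Rightarrow> int) \<Rightarrow> nat set" where
  "descents n w = {i. i < n \<and> cox_length n (w \<circ> cox_gen i) < cox_length n w}"

definition neg :: "nat \<Rightarrow> (int \<Rightarrow> int) \<Rightarrow> nat" where
  "neg n w = card {i \<in> {1..int n}. w i < 0}"

text \<open>The subtractions of natural numbers below do not truncate, because descents are less than $n$.\<close>

definition sigma_stat :: "nat \<Rightarrow> (int \<Rightarrow> int) \<Rightarrow> nat" where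
  "sigma_stat n w = (\<Sum>i\<in>descents n w. n\<^sup>2 - i\<^sup>2)"

definition rmaj :: "nat \<Rightarrow> (int \<Rightarrow> int) \<Rightarrow> nat" where
  "rmaj n w = (\<Sum>i\<in>descents n w. n - i)"

text \<open>
  The indeterminates live in the field of fractions of $\mathbb{Z}[X][Y][Z]$, that is, in
  $\mathbb{Q}(X,Y,Z)$.
\<close>

type_synonym ratfun3 = "int poly poly poly fract"

definition indet_X :: ratfun3 where "indet_X = to_fract [:[:[:0, 1:]:]:]"
definition indet_Y :: ratfun3 where "indet_Y = to_fract [:[:0, 1:]:]"
definition indet_Z :: ratfun3 where "indet_Z = to_fract [:0, 1:]"

end

theory Submission
  imports Defs "HOL-Combinatorics.Multiset_Permutations"
begin

text \<open>
  Write $w \in B_n$ as the word $w(1) \ldots w(n)$, put $u = X^{-1}$ and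
  $x_i = X^{n^2-i^2} Z^{n-i}$. The left-hand side is then
  $F_n(Y, Z) = \sum_w u^{l(w)} Y^{neg(w)} \prod_{i \in D(w)} x_i$. Grouping the words by an
  increasing prefix of $k$ positive letters gives
  $$F_n(Y,Z) = \sum_{k \le n} x_k \prod_{i<k} (1 - x_i)\, c_{n,k}(Y)\, F_{n-k}(0, X^{2k} Z),$$
  where $c_{n,k}$ sums over the possible sets of the remaining signed letters and satisfies
  $c_{n+1,k} = (1 + Y u^{n+1+k}) c_{n,k} + u^{n+1-k} c_{n,k-1}$. By a $q$-Vandermonde identity
  the right-hand side of the theorem satisfies the same recursion. For $Y = 0$, where only $k = 0$
  involves $F_n$ again, with the coefficient $x_0 \neq 1$, this proves the theorem by induction
  on $n$; the general case follows by applying the recursion once more.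
\<close>

subsection \<open>Signed permutations as words\<close>

text \<open>Ignoring the comparison at the cut makes the letters behind the prefix matter only
  through their relative order. They can be relabelled by 1, ..., n-k, so every smaller sum is taken
  at Y = 0 and all signs are absorbed by c_{n,k}, which counts the minimal coset representatives of
  B_n modulo B_k times S_{n-k} by length and number of negative letters. The shifted weights x_{k+i}
  have the same shape again, for n-k and with X^{2k} Z in place of Z; this is where the quadratic
  exponents enter, and it forces the induction to run over all Z. The recursion is therefore
  evaluated in an arbitrary field, with X nonzero and X^a Z^b never 1 for b > 0: a condition that is
  stable under this substitution and keeps the denominators, and 1 - x_0 for n > 0, away from
  zero.\<close>

fun invs :: "int list \<Rightarrow> nat" where
  "invs [] = 0"
| "invs (a # xs) = card {b \<in> set xs. b < a} + invs xs"

text \<open>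
  The pairs with \<open>c = d\<close> count the negative letters, so that \<open>invs xs + nsp (set xs)\<close> is the
  familiar type $B$ length $inv + neg + nsp$.
\<close>

definition nsp :: "int set \<Rightarrow> nat" where
  "nsp B = card {(c, d). c \<in> B \<and> d \<in> B \<and> c \<le> d \<and> c + d < 0}"

definition negs :: "int set \<Rightarrow> nat" where
  "negs B = card {b \<in> B. b < 0}"

lemma nsp_empty [simp]: "nsp {} = 0"
  by (simp add: nsp_def)

lemma negs_empty [simp]: "negs {} = 0"
  by (simp add: negs_def)

lemma negs_insert:
  assumes "finite B" "a \<notin> B"
  shows "negs (insert a B) = of_bool (a < 0) + negs B"
proof -
  have "{b \<in> insert a B. b < 0} = (if a < 0 then insert a {b \<in> B. b < 0} else {b \<in> B. b < 0})"
    by auto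
  thus ?thesis
    using assms by (simp add: negs_def)
qed

lemma nsp_insert:
  assumes "finite B" "a \<notin> B"
  shows "nsp (insert a B) = of_bool (a < 0) + card {b \<in> B. a + b < 0} + nsp B"
proof -
  let ?P = "\<lambda>B. {(c, d). c \<in> B \<and> d \<in> B \<and> c \<le> d \<and> c + d < (0::int)}"
  let ?D = "if a < 0 then {(a, a)} else {}"
  \<comment> \<open>The condition \<open>c \<le> d\<close> selects one ordering of each unordered
    pair, so the pair formed by \<open>a\<close> and \<open>b\<close> is stored in sorted form; the
    diagonal pair of \<open>a\<close> is \<open>?D\<close>.\<close>
  let ?f = "\<lambda>b. (min a b, max a b)"
  have fin: "finite (?P B)"
    by (rule finite_subset[of _ "B \<times> B"]) (use assms in auto)
  have inj: "inj_on ?f {b \<in> B. a + b < 0}"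
    by (auto simp: inj_on_def min_def max_def split: if_splits)
  have eq: "?P (insert a B) = ?D \<union> ?f ` {b \<in> B. a + b < 0} \<union> ?P B"
    by (auto simp: min_def max_def image_iff split: if_splits)
  have "card (?D \<union> ?f ` {b \<in> B. a + b < 0}) = card ?D + card (?f ` {b \<in> B. a + b < 0})"
    by (rule card_Un_disjoint) (use assms in \<open>auto simp: min_def max_def split: if_splits\<close>)
  moreover have "card (?D \<union> ?f ` {b \<in> B. a + b < 0} \<union> ?P B)
      = card (?D \<union> ?f ` {b \<in> B. a + b < 0}) + card (?P B)"
    by (rule card_Un_disjoint) (use assms fin in \<open>auto simp: min_def max_def split: if_splits\<close>)
  ultimately show ?thesis
    unfolding nsp_def eq using card_image[OF inj] by (simp add: nsp_def)
qed

definition signed_words :: "nat \<Rightarrow> int list set" where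
  "signed_words n = {xs. length xs = n \<and> distinct (map abs xs) \<and> abs ` set xs = {1..int n}}"

text \<open>The combinatorial candidate for \<open>cox_length\<close>. The part \<open>nsp\<close>
  sees only the set of letters, so rearranging letters affects \<open>invs\<close> alone.\<close>

definition signed_len :: "int list \<Rightarrow> nat" where
  "signed_len xs = invs xs + nsp (set xs)"

lemma invs_sorted: "sorted xs \<Longrightarrow> invs xs = 0"
  by (induction xs) (auto simp: not_less)

lemma invs_append_swap:
  assumes "a < b" "a \<notin> set ys" "b \<notin> set ys"
  shows "invs (xs @ b # a # ys) = Suc (invs (xs @ a # b # ys))"
proof (induction xs)
  case Nil
  have "{c \<in> set (a # ys). c < b} = insert a {c \<in> set ys. c < b}"
       "{c \<in> set (b # ys). c < a} = {c \<in> set ys. c < a}"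
    using assms by auto
  thus ?case using assms by simp
next
  case (Cons x xs)
  have "set (xs @ b # a # ys) = set (xs @ a # b # ys)" by auto
  thus ?case using Cons by simp
qed

section \<open>One-line notation of signed permutations\<close>

definition window :: "nat \<Rightarrow> (int \<Rightarrow> int) \<Rightarrow> int list" where
  "window n w = map (\<lambda>j. w (int j)) [1..<Suc n]"

lemma length_window [simp]: "length (window n w) = n"
  by (simp add: window_def)

lemma nth_window [simp]: "i < n \<Longrightarrow> window n w ! i = w (int i + 1)"
  by (simp add: window_def add.commute[of 1] del: upt_Suc)

lemma set_window: "set (window n w) = w ` {1..int n}"
proof -
  have "int ` {1..<Suc n} = {1..int n}"
    using image_int_atLeastAtMost[of 1 n] by (simp add: atLeastLessThanSuc_atLeastAtMost)
  hence "w ` {1..int n} = (\<lambda>j. w (int j)) ` {1..<Suc n}"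
    by (metis image_image)
  thus ?thesis
    unfolding window_def set_map set_upt by simp
qed

lemma hyperoctahedralD:
  assumes "w \<in> hyperoctahedral n"
  shows "w permutes {- int n..int n}" "w (- i) = - w i" "inj w" "w 0 = 0"
proof -
  show 1: "w permutes {- int n..int n}" and 2: "w (- i) = - w i" for i
    using assms by (auto simp: hyperoctahedral_def)
  show "inj w" using 1 by (rule permutes_inj)
  show "w 0 = 0" using 2[of 0] by simp
qed

lemma abs_hyperoctahedral:
  assumes "w \<in> hyperoctahedral n"
  shows "inj_on (\<lambda>i. \<bar>w i\<bar>) {1..}" "(\<lambda>i. \<bar>w i\<bar>) ` {1..int n} = {1..int n}"
proof -
  note w = hyperoctahedralD[OF assms]
  show inj: "inj_on (\<lambda>i. \<bar>w i\<bar>) {1..}"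
  proof (rule inj_onI)
    fix i j :: int assume ij: "i \<in> {1..}" "j \<in> {1..}" "\<bar>w i\<bar> = \<bar>w j\<bar>"
    hence "w i = w j \<or> w i = w (- j)" using w(2) by (auto simp: abs_eq_iff)
    hence "i = j \<or> i = - j" using w(3) by (auto dest: injD)
    thus "i = j" using ij by auto
  qed
  have sub: "(\<lambda>i. \<bar>w i\<bar>) ` {1..int n} \<subseteq> {1..int n}"
  proof safe
    fix i assume i: "i \<in> {1..int n}"
    hence "w i \<in> {- int n..int n}" using permutes_in_image[OF w(1), of i] by auto
    moreover have "w i \<noteq> 0" using w(3,4) i by (metis atLeastAtMost_iff injD not_one_le_zero)
    ultimately show "\<bar>w i\<bar> \<in> {1..int n}" by auto
  qed
  show "(\<lambda>i. \<bar>w i\<bar>) ` {1..int n} = {1..int n}"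
    by (rule endo_inj_surj) (use sub inj in \<open>auto intro: inj_on_subset\<close>)
qed

lemma window_in_signed_words:
  assumes "w \<in> hyperoctahedral n"
  shows "window n w \<in> signed_words n"
proof -
  have "inj_on (\<lambda>j. \<bar>w (int j)\<bar>) {1..<Suc n}"
  proof (rule inj_onI)
    fix i j assume "i \<in> {1..<Suc n}" "j \<in> {1..<Suc n}" "\<bar>w (int i)\<bar> = \<bar>w (int j)\<bar>"
    thus "i = j"
      using inj_onD[OF abs_hyperoctahedral(1)[OF assms], of "int i" "int j"] by simp
  qed
  thus ?thesis
    using abs_hyperoctahedral(2)[OF assms]
    by (simp add: signed_words_def set_window image_image)
       (simp add: window_def distinct_map comp_def del: upt_Suc)
qed

text \<open>Inverse of \<open>window\<close>: the values at 0 and at negative arguments are forced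
  by oddness.\<close>

definition unwindow :: "nat \<Rightarrow> int list \<Rightarrow> int \<Rightarrow> int" where
  "unwindow n xs i = (if 1 \<le> i \<and> i \<le> int n then xs ! nat (i - 1)
     else if - int n \<le> i \<and> i \<le> - 1 then - xs ! nat (- i - 1) else i)"

lemma unwindow:
  assumes "xs \<in> signed_words n"
  shows "unwindow n xs \<in> hyperoctahedral n" "window n (unwindow n xs) = xs"
proof -
  have xs: "length xs = n" "distinct (map abs xs)" "abs ` set xs = {1..int n}"
    using assms by (auto simp: signed_words_def)
  let ?w = "unwindow n xs"
  show "window n ?w = xs"
    using xs by (intro nth_equalityI) (auto simp: unwindow_def)
  have odd: "?w (- i) = - ?w i" for i
    by (auto simp: unwindow_def)
  have abs_in: "1 \<le> \<bar>xs ! j\<bar> \<and> \<bar>xs ! j\<bar> \<le> int n" if "j < n" for j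
  proof -
    have "\<bar>xs ! j\<bar> \<in> abs ` set xs" using that xs(1) by auto
    thus ?thesis using xs(3) by simp
  qed
  have abs_inj: "i = j" if "i < n" "j < n" "\<bar>xs ! i\<bar> = \<bar>xs ! j\<bar>" for i j
    using that xs(1,2) by (metis length_map nth_eq_iff_index_eq nth_map)
  have pos: "\<bar>?w i\<bar> = \<bar>xs ! nat (\<bar>i\<bar> - 1)\<bar>" if "1 \<le> \<bar>i\<bar>" "\<bar>i\<bar> \<le> int n" for i
    using that by (auto simp: unwindow_def)
  have zero: "?w 0 = 0" by (simp add: unwindow_def)
  have nz: "1 \<le> \<bar>?w i\<bar> \<and> \<bar>?w i\<bar> \<le> int n" if "1 \<le> \<bar>i\<bar>" "\<bar>i\<bar> \<le> int n" for i
    using that abs_in[of "nat (\<bar>i\<bar> - 1)"] pos[OF that] by auto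
  have nz0: "?w i \<noteq> 0" if "i \<noteq> 0" "i \<in> {- int n..int n}" for i
  proof -
    have "1 \<le> \<bar>i\<bar>" "\<bar>i\<bar> \<le> int n" using that by auto
    thus ?thesis using nz[of i] by linarith
  qed
  have inj: "inj_on ?w {- int n..int n}"
  proof (rule inj_onI)
    fix i j assume ij: "i \<in> {- int n..int n}" "j \<in> {- int n..int n}" "?w i = ?w j"
    show "i = j"
    proof (cases "i = 0 \<or> j = 0")
      case True
      thus ?thesis using ij zero nz0 by metis
    next
      case False
      hence r: "1 \<le> \<bar>i\<bar>" "\<bar>i\<bar> \<le> int n" "1 \<le> \<bar>j\<bar>" "\<bar>j\<bar> \<le> int n"
        using ij(1,2) by auto
      have "\<bar>xs ! nat (\<bar>i\<bar> - 1)\<bar> = \<bar>xs ! nat (\<bar>j\<bar> - 1)\<bar>"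
        using pos[OF r(1,2)] pos[OF r(3,4)] ij(3) by simp
      moreover have "nat (\<bar>i\<bar> - 1) < n" "nat (\<bar>j\<bar> - 1) < n"
        using r by (simp_all add: nat_less_iff)
      ultimately have "nat (\<bar>i\<bar> - 1) = nat (\<bar>j\<bar> - 1)"
        by (intro abs_inj)
      hence "\<bar>i\<bar> = \<bar>j\<bar>" using r by (simp add: eq_nat_nat_iff)
      moreover have "j \<noteq> - i"
      proof
        assume "j = - i"
        hence "?w i = - ?w i" using ij(3) odd by simp
        hence "?w i = 0" by simp
        thus False using nz[OF r(1,2)] by simp
      qed
      ultimately show ?thesis by auto
    qed
  qed
  have "?w ` {- int n..int n} \<subseteq> {- int n..int n}"
  proof safe
    fix i assume "i \<in> {- int n..int n}"
    hence "\<bar>?w i\<bar> \<le> int n"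
      using nz[of i] zero by (cases "i = 0") auto
    thus "?w i \<in> {- int n..int n}" by auto
  qed
  hence "?w ` {- int n..int n} = {- int n..int n}"
    using inj by (intro endo_inj_surj) auto
  hence "?w permutes {- int n..int n}"
    using inj by (intro bij_imp_permutes) (auto simp: bij_betw_def unwindow_def)
  thus "?w \<in> hyperoctahedral n"
    using odd by (simp add: hyperoctahedral_def)
qed

lemma unwindow_window:
  assumes "w \<in> hyperoctahedral n"
  shows "unwindow n (window n w) = w"
proof
  fix i
  note w = hyperoctahedralD[OF assms]
  have "i \<notin> {- int n..int n} \<Longrightarrow> w i = i"
    using w(1) by (rule permutes_not_in)
  moreover have "w i = - w (- i)" using w(2)[of i] by simp
  ultimately show "unwindow n (window n w) i = w i"
    using w(4) by (cases "i = 0") (auto simp: unwindow_def)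
qed

lemma window_bij:
  "bij_betw (window n) (hyperoctahedral n) (signed_words n)"
  by (rule bij_betw_byWitness[where f' = "unwindow n"])
     (use unwindow_window window_in_signed_words unwindow in auto)

subsection \<open>Coxeter length and descents\<close>

lemma cox_gen_0: "cox_gen 0 x = (if \<bar>x\<bar> = 1 then - x else x)"
  by (auto simp: cox_gen_def transpose_def)

lemma cox_gen_pos:
  assumes "i > 0"
  shows "cox_gen i x = (if \<bar>x\<bar> = int i then sgn x * (int i + 1)
    else if \<bar>x\<bar> = int i + 1 then sgn x * int i else x)"
proof -
  consider "x = int i" | "x = int i + 1" | "x = - int i" | "x = - (int i + 1)"
    | "\<bar>x\<bar> \<noteq> int i" "\<bar>x\<bar> \<noteq> int i + 1" by linarith
  thus ?thesis
    using assms by cases (auto simp: cox_gen_def transpose_def)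
qed

lemma cox_gen_involution: "cox_gen i (cox_gen i x) = x"
proof (cases "i = 0")
  case False
  consider "x = int i" | "x = int i + 1" | "x = - int i" | "x = - (int i + 1)"
    | "\<bar>x\<bar> \<noteq> int i" "\<bar>x\<bar> \<noteq> int i + 1" by linarith
  thus ?thesis using False by cases (auto simp: cox_gen_pos)
qed (auto simp: cox_gen_0)

lemma cox_gen_hyperoctahedral:
  assumes "i < n"
  shows "cox_gen i \<in> hyperoctahedral n"
proof -
  have odd: "cox_gen i (- x) = - cox_gen i x" for x
    by (cases "i = 0") (auto simp: cox_gen_0 cox_gen_pos)
  have outside: "cox_gen i x = x" if "x \<notin> {- int n..int n}" for x
  proof -
    have "\<bar>x\<bar> > int n" using that by auto
    hence "\<bar>x\<bar> \<noteq> int i" "\<bar>x\<bar> \<noteq> int i + 1" using assms by auto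
    thus ?thesis using assms by (cases "i = 0") (auto simp: cox_gen_0 cox_gen_pos)
  qed
  have "bij (cox_gen i)"
    by (rule bij_betw_byWitness[where f' = "cox_gen i"]) (auto simp: cox_gen_involution)
  hence "cox_gen i permutes {- int n..int n}"
    using outside by (simp add: permutes_def bij_iff)
  thus ?thesis using odd by (simp add: hyperoctahedral_def)
qed

lemma comp_hyperoctahedral:
  "v \<in> hyperoctahedral n \<Longrightarrow> w \<in> hyperoctahedral n \<Longrightarrow> v \<circ> w \<in> hyperoctahedral n"
  by (auto simp: hyperoctahedral_def intro: permutes_compose)

lemma id_hyperoctahedral: "id \<in> hyperoctahedral n"
  by (simp add: hyperoctahedral_def permutes_id)

lemma window_cox_gen_0:
  "window (Suc m) (w \<circ> cox_gen 0) = w (- 1) # tl (window (Suc m) w)"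
  by (rule nth_equalityI) (auto simp: nth_Cons' nth_tl cox_gen_0)

text \<open>Right multiplication acts on positions. List indices start at 0, so
  \<open>w (int i)\<close> stands at index \<open>i - 1\<close>.\<close>

lemma window_cox_gen_pos:
  assumes "0 < i" "i < n"
  shows "window n (w \<circ> cox_gen i)
    = take (i - 1) (window n w) @ w (int i + 1) # w (int i) # drop (i + 1) (window n w)"
proof (rule nth_equalityI)
  fix j assume "j < length (window n (w \<circ> cox_gen i))"
  hence j: "j < n" by simp
  consider "j < i - 1" | "j = i - 1" | "j = i" | "j > i" by linarith
  thus "window n (w \<circ> cox_gen i) ! j =
      (take (i - 1) (window n w) @ w (int i + 1) # w (int i) # drop (i + 1) (window n w)) ! j"
  proof cases
    case 4
    hence "j - (i - 1) = Suc (Suc (j - Suc i))" using assms by auto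
    thus ?thesis using 4 assms j by (auto simp: nth_append cox_gen_pos)
  qed (use assms j in \<open>auto simp: nth_append cox_gen_pos nth_Cons'\<close>)
qed (use assms in auto)

lemma window_split:
  assumes "0 < i" "i < n"
  shows "window n w
    = take (i - 1) (window n w) @ w (int i) # w (int i + 1) # drop (i + 1) (window n w)"
proof -
  have "drop (i - 1) (window n w) = w (int i) # drop i (window n w)"
    using assms Cons_nth_drop_Suc[of "i - 1" "window n w"] by simp
  moreover have "drop i (window n w) = w (int i + 1) # drop (i + 1) (window n w)"
    using assms Cons_nth_drop_Suc[of i "window n w"] by simp
  ultimately show ?thesis
    by (metis append_take_drop_id)
qed

text \<open>For \<open>i > 0\<close> the letter set stays the same and one inversion is created. For
  \<open>i = 0\<close> the ascent means \<open>w 1 > 0\<close>, as \<open>w 0 = 0\<close>; negating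
  this letter interchanges its contributions to \<open>invs\<close> and to the mixed pairs of
  \<open>nsp\<close>, and the gain is its diagonal pair.\<close>

lemma signed_len_cox_gen_ascent:
  assumes w: "w \<in> hyperoctahedral n" and i: "i < n" and asc: "w (int i) < w (int i + 1)"
  shows "signed_len (window n (w \<circ> cox_gen i)) = Suc (signed_len (window n w))"
proof (cases "i = 0")
  case True
  then obtain m where n: "n = Suc m" using i by (cases n) auto
  let ?a = "w 1"
  have pos: "?a > 0" using asc True hyperoctahedralD(4)[OF w] by simp
  obtain a ys where "window n w = a # ys"
    using n length_window[of n w] by (metis length_Suc_conv)
  moreover have "window n w ! 0 = ?a" using n by simp
  ultimately have win: "window n w = ?a # ys" by simp
  have win': "window n (w \<circ> cox_gen i) = - ?a # ys"
    using True n win window_cox_gen_0[of m w] hyperoctahedralD(2)[OF w, of 1] by simp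
  have "distinct (map abs (?a # ys))"
    using window_in_signed_words[OF w] win by (simp add: signed_words_def)
  hence nin: "?a \<notin> set ys" "- ?a \<notin> set ys"
    using abs_minus_cancel[of ?a] by (auto simp: image_iff)
  have "{b \<in> set ys. b < - ?a} = {b \<in> set ys. ?a + b < 0}"
       "{b \<in> set ys. - ?a + b < 0} = {b \<in> set ys. b < ?a}"
    by auto
  thus ?thesis
    unfolding win' win using pos nin by (simp add: signed_len_def nsp_insert)
next
  case False
  hence pos: "0 < i" by simp
  let ?xs = "take (i - 1) (window n w)" and ?ys = "drop (i + 1) (window n w)"
  have "distinct (window n w)"
    using window_in_signed_words[OF w] by (simp add: signed_words_def distinct_map)
  hence "distinct (?xs @ w (int i) # w (int i + 1) # ?ys)"
    using window_split[OF pos i] by metis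
  hence nin: "w (int i) \<notin> set ?ys" "w (int i + 1) \<notin> set ?ys" by auto
  have "signed_len (?xs @ w (int i + 1) # w (int i) # ?ys)
      = Suc (signed_len (?xs @ w (int i) # w (int i + 1) # ?ys))"
    using invs_append_swap[OF asc nin]
    by (simp add: signed_len_def insert_commute)
  thus ?thesis
    using window_split[OF pos i] window_cox_gen_pos[OF pos i] by metis
qed

text \<open>The ascent case for \<open>w \<circ> cox_gen i\<close>, since generators are
  involutions.\<close>

lemma signed_len_cox_gen_descent:
  assumes w: "w \<in> hyperoctahedral n" and i: "i < n" and desc: "w (int i + 1) < w (int i)"
  shows "signed_len (window n w) = Suc (signed_len (window n (w \<circ> cox_gen i)))"
proof -
  let ?v = "w \<circ> cox_gen i"
  have v: "?v \<in> hyperoctahedral n"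
    by (intro comp_hyperoctahedral w cox_gen_hyperoctahedral i)
  have "?v (int i) < ?v (int i + 1)"
    using desc hyperoctahedralD(2)[OF w, of 1] hyperoctahedralD(4)[OF w]
    by (cases "i = 0") (auto simp: cox_gen_0 cox_gen_pos)
  moreover have "?v \<circ> cox_gen i = w"
    by (auto simp: cox_gen_involution)
  ultimately show ?thesis
    using signed_len_cox_gen_ascent[OF v i] by simp
qed

lemma hyperoctahedral_neq_Suc:
  assumes "w \<in> hyperoctahedral n"
  shows "w (int i + 1) \<noteq> w (int i)"
  using injD[OF hyperoctahedralD(3)[OF assms], of "int i + 1" "int i"] by auto

text \<open>Integers that increase strictly from \<open>w 0 = 0\<close> satisfy
  \<open>w i \<ge> i\<close>; going down from \<open>w n \<le> n\<close> gives the opposite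
  bound.\<close>

lemma hyperoctahedral_no_descent:
  assumes w: "w \<in> hyperoctahedral n" and asc: "\<And>i. i < n \<Longrightarrow> w (int i) < w (int i + 1)"
  shows "w = id"
proof -
  have ge: "int i \<le> w (int i)" if "i \<le> n" for i
    using that
  proof (induction i)
    case 0 thus ?case using hyperoctahedralD(4)[OF w] by simp
  next
    case (Suc i) thus ?case using asc[of i] by (simp add: add.commute)
  qed
  have le: "w (int (n - k)) \<le> int (n - k)" if "k \<le> n" for k
    using that
  proof (induction k)
    case 0
    have "w (int n) \<in> {- int n..int n}"
      using permutes_in_image[OF hyperoctahedralD(1)[OF w], of "int n"] by auto
    thus ?case by simp
  next
    case (Suc k)
    have "int (n - Suc k) + 1 = int (n - k)" using Suc.prems by auto
    thus ?case using asc[of "n - Suc k"] Suc by simp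
  qed
  have "window n w = window n id"
  proof (rule nth_equalityI)
    fix j assume "j < length (window n w)"
    hence j: "j < n" by simp
    hence "w (int (Suc j)) = int (Suc j)"
      using ge[of "Suc j"] le[of "n - Suc j"] by simp
    thus "window n w ! j = window n id ! j" using j by (simp add: add.commute)
  qed simp
  thus ?thesis
    using w id_hyperoctahedral unwindow_window by metis
qed

section \<open>Words in the generators and their lengths\<close>

lemma word_prod_Nil: "word_prod [] = id"
  by (auto simp: word_prod_def)

lemma word_prod_append: "word_prod (is @ js) = word_prod is \<circ> word_prod js"
  unfolding word_prod_def by (induction "is") (auto simp: fun_eq_iff)

lemma word_prod_snoc: "word_prod (is @ [i]) = word_prod is \<circ> cox_gen i"
  unfolding word_prod_append by (simp add: word_prod_def)

lemma word_prod_hyperoctahedral: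
  "set is \<subseteq> {..<n} \<Longrightarrow> word_prod is \<in> hyperoctahedral n"
proof (induction "is" rule: rev_induct)
  case Nil show ?case unfolding word_prod_Nil by (rule id_hyperoctahedral)
next
  case (snoc i "is")
  hence "word_prod is \<in> hyperoctahedral n" "cox_gen i \<in> hyperoctahedral n"
    using cox_gen_hyperoctahedral by auto
  thus ?case unfolding word_prod_snoc by (rule comp_hyperoctahedral)
qed

lemma signed_len_id: "signed_len (window n id) = 0"
proof -
  have "invs (window n id) = 0"
    by (rule invs_sorted) (auto simp: sorted_iff_nth_mono)
  moreover have "nsp (set (window n id)) = 0"
    unfolding nsp_def by (rule card_eq_0_iff[THEN iffD2]) (auto simp: set_window)
  ultimately show ?thesis by (simp add: signed_len_def)
qed

text \<open>Each generator changes \<open>signed_len\<close> by exactly one, starting from 0 at the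
  identity. This is the lower bound for \<open>cox_length\<close>.\<close>

lemma signed_len_word_prod_le:
  "set is \<subseteq> {..<n} \<Longrightarrow> signed_len (window n (word_prod is)) \<le> length is"
proof (induction "is" rule: rev_induct)
  case Nil show ?case unfolding word_prod_Nil signed_len_id by simp
next
  case (snoc i "is")
  have i: "i < n" and w: "word_prod is \<in> hyperoctahedral n"
    using snoc.prems word_prod_hyperoctahedral by auto
  consider "word_prod is (int i) < word_prod is (int i + 1)"
    | "word_prod is (int i + 1) < word_prod is (int i)"
    using hyperoctahedral_neq_Suc[OF w, of i] by linarith
  hence "signed_len (window n (word_prod is \<circ> cox_gen i)) \<le> Suc (signed_len (window n (word_prod is)))"
    by cases (use signed_len_cox_gen_ascent[OF w i] signed_len_cox_gen_descent[OF w i] in linarith)+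
  moreover have "signed_len (window n (word_prod is)) \<le> length is"
    using snoc by simp
  ultimately show ?case
    unfolding word_prod_snoc length_append_singleton by linarith
qed

text \<open>Removing a descent lowers \<open>signed_len\<close> by one, and the process can only
  stop at the identity. This gives the upper bound for \<open>cox_length\<close> and shows that the
  generators generate.\<close>

lemma reduced_word_exists:
  assumes "w \<in> hyperoctahedral n"
  shows "\<exists>is. length is = signed_len (window n w) \<and> set is \<subseteq> {..<n} \<and> word_prod is = w"
  using assms
proof (induction "signed_len (window n w)" arbitrary: w rule: less_induct)
  case less
  show ?case
  proof (cases "\<exists>i<n. w (int i + 1) < w (int i)")
    case True
    then obtain i where i: "i < n" "w (int i + 1) < w (int i)" by blast
    let ?v = "w \<circ> cox_gen i"
    have v: "?v \<in> hyperoctahedral n"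
      by (intro comp_hyperoctahedral less.prems cox_gen_hyperoctahedral i)
    have len: "signed_len (window n w) = Suc (signed_len (window n ?v))"
      by (rule signed_len_cox_gen_descent[OF less.prems i])
    obtain "is" where "length is = signed_len (window n ?v)" "set is \<subseteq> {..<n}" "word_prod is = ?v"
      using less.hyps[OF _ v] len by auto
    moreover have "?v \<circ> cox_gen i = w" by (auto simp: cox_gen_involution)
    ultimately show ?thesis
      using len i by (intro exI[of _ "is @ [i]"]) (simp add: word_prod_snoc)
  next
    case False
    hence "w = id"
      using hyperoctahedral_no_descent[OF less.prems] hyperoctahedral_neq_Suc[OF less.prems]
      by (meson linorder_neqE)
    thus ?thesis
      using word_prod_Nil signed_len_id[of n] by (intro exI[of _ "[]"]) (metis empty_iff list.size(3) set_empty subsetI)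
  qed
qed

lemma cox_length_eq_signed_len:
  assumes "w \<in> hyperoctahedral n"
  shows "cox_length n w = signed_len (window n w)"
  unfolding cox_length_def
  by (rule Least_equality) (use reduced_word_exists[OF assms] signed_len_word_prod_le in auto)

text \<open>The convention \<open>w 0 = 0\<close> treats the descent at 0, that is
  \<open>w 1 < 0\<close>, like all the others.\<close>

lemma descents_eq:
  assumes w: "w \<in> hyperoctahedral n"
  shows "descents n w = {i. i < n \<and> w (int i + 1) < w (int i)}"
proof -
  have "cox_length n (w \<circ> cox_gen i) < cox_length n w \<longleftrightarrow> w (int i + 1) < w (int i)"
    if i: "i < n" for i
  proof -
    have "w \<circ> cox_gen i \<in> hyperoctahedral n"
      by (intro comp_hyperoctahedral w cox_gen_hyperoctahedral i)
    thus ?thesis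
      using signed_len_cox_gen_ascent[OF w i] signed_len_cox_gen_descent[OF w i]
        hyperoctahedral_neq_Suc[OF w, of i]
      by (cases "w (int i + 1) < w (int i)") (auto simp: cox_length_eq_signed_len[OF w] cox_length_eq_signed_len)
  qed
  thus ?thesis by (auto simp: descents_def)
qed

subsection \<open>Sums over words\<close>

lemma invs_append:
  assumes "distinct xs" "set xs \<inter> set ys = {}"
  shows "invs (xs @ ys) = invs xs + invs ys + (\<Sum>a\<in>set xs. card {b \<in> set ys. b < a})"
  using assms
proof (induction xs)
  case (Cons a xs)
  have "{b \<in> set (xs @ ys). b < a} = {b \<in> set xs. b < a} \<union> {b \<in> set ys. b < a}" by auto
  moreover have "card ({b \<in> set xs. b < a} \<union> {b \<in> set ys. b < a})
      = card {b \<in> set xs. b < a} + card {b \<in> set ys. b < a}"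
    by (rule card_Un_disjoint) (use Cons.prems in auto)
  ultimately show ?case using Cons by simp
qed simp

text \<open>A pair inside \<open>K\<close> has positive sum, which leaves the pairs inside
  \<open>B\<close> and the mixed ones.\<close>

lemma nsp_Un_positive:
  assumes "finite K" "finite B" "K \<inter> B = {}" "\<And>a. a \<in> K \<Longrightarrow> a > 0"
  shows "nsp (K \<union> B) = nsp B + (\<Sum>a\<in>K. card {b \<in> B. a + b < 0})"
  using assms(1,3,4)
proof (induction K)
  case (insert a K)
  have "{b \<in> K \<union> B. a + b < 0} = {b \<in> B. a + b < 0}"
    using insert.prems(2) by (smt (verit) Collect_cong Un_iff insertCI)
  moreover have "\<not> a < 0" using insert.prems(2)[of a] by simp
  ultimately show ?case
    using insert assms(2) by (simp add: nsp_insert)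
qed simp

lemma invs_map:
  assumes "strict_mono_on (set xs) h"
  shows "invs (map h xs) = invs xs"
  using assms
proof (induction xs)
  case (Cons a xs)
  have less: "h b < h a \<longleftrightarrow> b < a" if "b \<in> set xs" for b
    using strict_mono_on_less[OF Cons.prems, of b a] that by simp
  have inj: "inj_on h (set (a # xs))"
    by (rule strict_mono_on_imp_inj_on[OF Cons.prems])
  have "{b \<in> set (map h xs). b < h a} = h ` {b \<in> set xs. b < a}"
    using less by auto
  hence "card {b \<in> set (map h xs). b < h a} = card {b \<in> set xs. b < a}"
    using inj by (auto intro!: card_image elim: inj_on_subset)
  moreover have "strict_mono_on (set xs) h"
    using Cons.prems by (auto simp: monotone_on_def)
  ultimately show ?case using Cons.IH by simp
qed simp

text \<open>The argument \<open>p\<close> is the letter preceding the word, and \<open>x 0\<close>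
  weighs the comparison with it. Taking \<open>p = 0\<close> gives the descents of a signed
  permutation; taking \<open>p\<close> to be the head of the word silences the first
  comparison.\<close>

fun desc_prod :: "(nat \<Rightarrow> 'a::comm_monoid_mult) \<Rightarrow> int \<Rightarrow> int list \<Rightarrow> 'a" where
  "desc_prod x p [] = 1"
| "desc_prod x p (a # xs) = (if a < p then x 0 else 1) * desc_prod (\<lambda>i. x (Suc i)) a xs"

lemma desc_prod_eq:
  "desc_prod x p xs = (\<Prod>i<length xs. if xs ! i < (p # xs) ! i then x i else 1)"
  by (induction x p xs rule: desc_prod.induct)
     (simp_all only: desc_prod.simps length_Cons prod.lessThan_Suc_shift nth_Cons_Suc nth_Cons_0,
      simp_all)

lemma desc_prod_map:
  assumes "strict_mono_on (insert p (set xs)) h"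
  shows "desc_prod x (h p) (map h xs) = desc_prod x p xs"
  using assms
proof (induction x p xs rule: desc_prod.induct)
  case (2 x p a xs)
  have "strict_mono_on (insert a (set xs)) h"
    using 2(2) by (auto simp: monotone_on_def)
  moreover have "h a < h p \<longleftrightarrow> a < p"
    using strict_mono_on_less[OF 2(2), of a p] by simp
  ultimately show ?case using 2(1) by simp
qed simp

lemma desc_prod_hd:
  "(\<And>a. a \<in> set xs \<Longrightarrow> p \<le> a) \<Longrightarrow> desc_prod x p xs = desc_prod x (hd xs) xs"
  by (cases xs) (simp_all add: leD)

text \<open>
  A word is grouped with the words sharing its increasing prefix of length \<open>k\<close>; the factors
  \<open>1 - x i\<close> make the sum over \<open>k\<close> telescope.
\<close>

lemma desc_prod_expansion:
  fixes x :: "nat \<Rightarrow> 'a::comm_ring_1"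
  assumes "distinct (p # xs)" "x (length xs) = 1"
  shows "desc_prod x p xs = (\<Sum>k\<le>length xs. of_bool (sorted_wrt (<) (p # take k xs)) *
    (x k * (\<Prod>i<k. 1 - x i) * desc_prod (\<lambda>i. x (k + i)) (hd (drop k xs)) (drop k xs)))"
  using assms
proof (induction xs arbitrary: p x)
  case (Cons a xs)
  let ?x = "\<lambda>i. x (Suc i)"
  have IH: "desc_prod ?x a xs = (\<Sum>k\<le>length xs. of_bool (sorted_wrt (<) (a # take k xs)) *
    (?x k * (\<Prod>i<k. 1 - ?x i) * desc_prod (\<lambda>i. ?x (k + i)) (hd (drop k xs)) (drop k xs)))"
    by (rule Cons.IH) (use Cons.prems in auto)
  have sorted: "sorted_wrt (<) (p # a # take k xs) \<longleftrightarrow> p < a \<and> sorted_wrt (<) (a # take k xs)" for k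
    by auto
  \<comment> \<open>The term \<open>k = 0\<close> is \<open>x 0\<close> times the product with
    silenced first comparison. The other terms carry a common factor \<open>1 - x 0\<close> and form
    the induction hypothesis if \<open>p < a\<close>, or vanish otherwise; so the total factor is 1
    at an ascent and \<open>x 0\<close> at a descent.\<close>
  have "(\<Sum>k\<le>length (a # xs). of_bool (sorted_wrt (<) (p # take k (a # xs))) *
      (x k * (\<Prod>i<k. 1 - x i) *
        desc_prod (\<lambda>i. x (k + i)) (hd (drop k (a # xs))) (drop k (a # xs))))
    = x 0 * desc_prod ?x a xs
      + (\<Sum>k\<le>length xs. of_bool (sorted_wrt (<) (p # a # take k xs)) *
      (?x k * ((1 - x 0) * (\<Prod>i<k. 1 - ?x i)) *
        desc_prod (\<lambda>i. ?x (k + i)) (hd (drop k xs)) (drop k xs)))"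
    unfolding length_Cons sum.atMost_Suc_shift prod.lessThan_Suc_shift by simp
  also have "\<dots> = x 0 * desc_prod ?x a xs + of_bool (p < a) * (1 - x 0) * desc_prod ?x a xs"
    unfolding IH sorted sum_distrib_left of_bool_conj
    by (intro arg_cong2[where f = "(+)"] refl sum.cong) (simp add: mult_ac)
  also have "\<dots> = desc_prod x p (a # xs)"
    using Cons.prems(1) by (cases "p < a") (auto simp: algebra_simps)
  finally show ?case ..
qed simp

text \<open>The comparison in front of the first letter is silenced because the expansion already
  accounts for the cut through \<open>x k\<close>.\<close>

definition perm_sum :: "'a::comm_ring_1 \<Rightarrow> nat \<Rightarrow> (nat \<Rightarrow> 'a) \<Rightarrow> 'a" where
  "perm_sum u m x = (\<Sum>ys\<in>permutations_of_set {1..int m}. u ^ invs ys * desc_prod x (hd ys) ys)"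

text \<open>Standardization: the increasing bijection \<open>h\<close> from an initial interval onto
  \<open>B\<close> preserves inversions and descents.\<close>

lemma perm_sum_eq:
  assumes "finite B"
  shows "(\<Sum>ys\<in>permutations_of_set B. u ^ invs ys * desc_prod x (hd ys) ys) = perm_sum u (card B) x"
proof -
  define l where "l = sorted_list_of_set B"
  have l: "length l = card B" "set l = B" "sorted_wrt (<) l"
    using assms by (auto simp: l_def)
  define h where "h = (\<lambda>i::int. l ! nat (i - 1))"
  let ?A = "{1..int (card B)}"
  have mono: "strict_mono_on ?A h"
  proof (rule strict_mono_onI)
    fix i j assume "i \<in> ?A" "j \<in> ?A" "i < j"
    thus "h i < h j"
      unfolding h_def by (intro sorted_wrt_nth_less[OF l(3)]) (use l in auto)
  qed
  have "h ` ?A = B"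
  proof -
    have "h ` ?A = (\<lambda>j. l ! j) ` {..<length l}"
    proof (intro equalityI image_subsetI)
      fix i assume "i \<in> ?A"
      thus "h i \<in> (\<lambda>j. l ! j) ` {..<length l}"
        using l by (auto simp: h_def)
    next
      fix j assume "j \<in> {..<length l}"
      thus "l ! j \<in> h ` ?A"
        using l by (intro image_eqI[of _ _ "int j + 1"]) (auto simp: h_def)
    qed
    also have "\<dots> = set l" by (auto simp: set_conv_nth)
    finally show ?thesis using l by simp
  qed
  hence "permutations_of_set B = map h ` permutations_of_set ?A"
    using permutations_of_set_image_inj[OF strict_mono_on_imp_inj_on[OF mono]] by simp
  moreover have "inj_on (map h) (permutations_of_set ?A)"
    using strict_mono_on_imp_inj_on[OF mono]
    by (intro inj_on_mapI) (auto simp: permutations_of_set_def)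
  moreover have "invs (map h ys) = invs ys"
      "desc_prod x (hd (map h ys)) (map h ys) = desc_prod x (hd ys) ys"
    if "ys \<in> permutations_of_set ?A" for ys
  proof -
    have set: "set ys = ?A" using that by (simp add: permutations_of_set_def)
    show "invs (map h ys) = invs ys" by (rule invs_map) (use set mono in simp)
    show "desc_prod x (hd (map h ys)) (map h ys) = desc_prod x (hd ys) ys"
    proof (cases "ys = []")
      case False
      hence "insert (hd ys) (set ys) = set ys" by auto
      thus ?thesis
        using desc_prod_map[of "hd ys" ys h x] set mono False by (simp add: hd_map)
    qed simp
  qed
  ultimately show ?thesis
    by (simp add: perm_sum_def sum.reindex)
qed

definition signed_sum :: "'a::comm_ring_1 \<Rightarrow> 'a \<Rightarrow> nat \<Rightarrow> (nat \<Rightarrow> 'a) \<Rightarrow> 'a" where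
  "signed_sum u Y n x =
    (\<Sum>xs\<in>signed_words n. u ^ signed_len xs * Y ^ negs (set xs) * desc_prod x 0 xs)"

lemma finite_signed_words: "finite (signed_words n)"
proof (rule finite_subset)
  show "signed_words n \<subseteq> {xs. set xs \<subseteq> {- int n..int n} \<and> length xs = n}"
  proof safe
    fix xs a assume "xs \<in> signed_words n" "a \<in> set xs"
    hence "\<bar>a\<bar> \<in> {1..int n}" unfolding signed_words_def by blast
    thus "a \<in> {- int n..int n}" by auto
  qed (simp add: signed_words_def)
qed (simp add: finite_lists_length_eq)

text \<open>As \<open>0 ^ 0 = 1\<close>, putting \<open>Y = 0\<close> keeps exactly the words
  without negative letters. On these \<open>nsp\<close> vanishes, and the preceding letter 0 never
  causes a descent.\<close>

lemma signed_sum_0: "signed_sum u 0 n x = perm_sum u n x"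
  unfolding signed_sum_def perm_sum_def
proof (rule sum.mono_neutral_cong_right)
  show "permutations_of_set {1..int n} \<subseteq> signed_words n"
  proof
    fix xs assume "xs \<in> permutations_of_set {1..int n}"
    hence xs: "set xs = {1..int n}" "distinct xs" by (auto simp: permutations_of_set_def)
    have "map abs xs = xs" using xs(1) by (intro map_idI) auto
    moreover have "length xs = n" using distinct_card[OF xs(2)] xs(1) by simp
    ultimately show "xs \<in> signed_words n"
      using xs by (simp add: signed_words_def flip: set_map)
  qed
next
  show "\<forall>xs\<in>signed_words n - permutations_of_set {1..int n}.
      u ^ signed_len xs * 0 ^ negs (set xs) * desc_prod x 0 xs = 0"
  proof
    fix xs assume xs: "xs \<in> signed_words n - permutations_of_set {1..int n}"
    have "negs (set xs) \<noteq> 0"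
    proof
      assume "negs (set xs) = 0"
      hence "\<forall>a\<in>set xs. \<not> a < 0" by (auto simp: negs_def)
      hence map: "map abs xs = xs" by (intro map_idI) auto
      hence "abs ` set xs = set xs" by (metis set_map)
      thus False
        using xs map by (auto simp: signed_words_def permutations_of_set_def)
    qed
    thus "u ^ signed_len xs * 0 ^ negs (set xs) * desc_prod x 0 xs = 0"
      by (simp add: power_0_left)
  qed
next
  fix xs assume "xs \<in> permutations_of_set {1..int n}"
  hence xs: "set xs = {1..int n}" by (auto simp: permutations_of_set_def)
  have "desc_prod x 0 xs = desc_prod x (hd xs) xs"
    by (rule desc_prod_hd) (simp add: xs)
  moreover have "negs (set xs) = 0" "nsp (set xs) = 0"
    unfolding negs_def nsp_def by (rule card_eq_0_iff[THEN iffD2], force simp: xs)+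
  ultimately show "u ^ signed_len xs * 0 ^ negs (set xs) * desc_prod x 0 xs
      = u ^ invs xs * desc_prod x (hd xs) xs"
    by (simp add: signed_len_def)
qed (rule finite_signed_words)

subsection \<open>Splitting off an increasing prefix\<close>

text \<open>
  The data left of a signed word after deleting its increasing prefix of length \<open>k\<close> and
  forgetting the order of the remaining letters.
\<close>

definition letter_sets :: "nat \<Rightarrow> nat \<Rightarrow> int set set" where
  "letter_sets n k = {B. abs ` B \<subseteq> {1..int n} \<and> inj_on abs B \<and> card B + k = n}"

text \<open>The length of the word that lists the missing absolute values in increasing order and
  then \<open>B\<close> in increasing order, a minimal coset representative. The sum collects the
  inversions and the negative sums between prefix and \<open>B\<close>.\<close>

definition cross_len :: "nat \<Rightarrow> int set \<Rightarrow> nat" where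
  "cross_len n B =
    nsp B + (\<Sum>a\<in>{1..int n} - abs ` B. card {b \<in> B. b < a} + card {b \<in> B. a + b < 0})"

definition coset_sum :: "'a::comm_ring_1 \<Rightarrow> 'a \<Rightarrow> nat \<Rightarrow> nat \<Rightarrow> 'a" where
  "coset_sum u Y n k = (\<Sum>B\<in>letter_sets n k. u ^ cross_len n B * Y ^ negs B)"

lemma letter_setsD:
  assumes "B \<in> letter_sets n k"
  shows "finite B" "card B + k = n" "card ({1..int n} - abs ` B) = k" "b \<in> B \<Longrightarrow> 1 \<le> \<bar>b\<bar> \<and> \<bar>b\<bar> \<le> int n"
proof -
  have B: "abs ` B \<subseteq> {1..int n}" "inj_on abs B" "card B + k = n"
    using assms by (auto simp: letter_sets_def)
  show "finite B" using B(1,2) by (metis finite_atLeastAtMost_int finite_imageD finite_subset)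
  have "card (abs ` B) = card B" by (rule card_image[OF B(2)])
  thus "card ({1..int n} - abs ` B) = k"
    using B card_Diff_subset[OF finite_subset[OF B(1)] B(1)] by simp
  show "card B + k = n" by fact
  show "1 \<le> \<bar>b\<bar> \<and> \<bar>b\<bar> \<le> int n" if "b \<in> B"
    using B(1) that by (metis atLeastAtMost_iff image_subset_iff)
qed

lemma finite_letter_sets: "finite (letter_sets n k)"
proof (rule finite_subset)
  show "letter_sets n k \<subseteq> Pow {- int n..int n}"
  proof safe
    fix B b assume "B \<in> letter_sets n k" "b \<in> B"
    thus "b \<in> {- int n..int n}" using letter_setsD(4)[of B n k b] by auto
  qed
qed simp

text \<open>The largest absolute value occurs in \<open>B\<close> with sign plus, or with sign
  minus, or belongs to the prefix, which is then one letter longer than before.\<close>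

lemma letter_sets_Suc:
  fixes n k :: nat
  defines "N \<equiv> int (Suc n)"
  shows "letter_sets (Suc n) k = insert N ` letter_sets n k \<union> insert (- N) ` letter_sets n k
    \<union> (if k = 0 then {} else letter_sets n (k - 1))"
proof (intro equalityI subsetI)
  fix B assume B: "B \<in> letter_sets (Suc n) k"
  note fin = letter_setsD(1)[OF B] and range = letter_setsD(4)[OF B]
  have inj: "inj_on abs B" using B by (simp add: letter_sets_def)
  have small: "abs ` C \<subseteq> {1..int n}" if "C \<subseteq> B" "N \<notin> C" "- N \<notin> C" for C
  proof
    fix c assume "c \<in> abs ` C"
    then obtain b where b: "b \<in> C" "c = \<bar>b\<bar>" by auto
    hence "b \<noteq> N" "b \<noteq> - N" "1 \<le> \<bar>b\<bar>" "\<bar>b\<bar> \<le> N"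
      using that range[of b] by (auto simp: N_def)
    thus "c \<in> {1..int n}" using b(2) by (auto simp: N_def)
  qed
  have both: "\<not> (N \<in> B \<and> - N \<in> B)"
    using inj_onD[OF inj, of N "- N"] by (auto simp: N_def)
  have remove: "B - {c} \<in> letter_sets n k" if "c \<in> B" "c = N \<or> c = - N" for c
  proof -
    have "abs ` (B - {c}) \<subseteq> {1..int n}"
      by (rule small) (use that both in auto)
    moreover have "card B = Suc (card (B - {c}))"
      using card_Suc_Diff1[OF fin that(1)] by simp
    ultimately show ?thesis
      using B inj_on_subset[OF inj, of "B - {c}"] by (simp add: letter_sets_def)
  qed
  consider "N \<in> B" | "- N \<in> B" | "N \<notin> B" "- N \<notin> B" by blast
  thus "B \<in> insert N ` letter_sets n k \<union> insert (- N) ` letter_sets n k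
      \<union> (if k = 0 then {} else letter_sets n (k - 1))"
  proof cases
    case 1
    thus ?thesis using remove[of N] insert_Diff[of N B] by (metis UnI1 image_eqI)
  next
    case 2
    thus ?thesis using remove[of "- N"] insert_Diff[of "- N" B] by (metis UnI1 UnI2 image_eqI)
  next
    case 3
    hence sub: "abs ` B \<subseteq> {1..int n}" by (intro small) auto
    \<comment> \<open>Together with \<open>card B + k = Suc n\<close> this excludes
      \<open>k = 0\<close>.\<close>
    hence "card B \<le> n"
      using card_mono[OF _ sub] card_image[OF inj] by simp
    thus ?thesis
      using B sub by (auto simp: letter_sets_def)
  qed
next
  have ins: "insert c B \<in> letter_sets (Suc n) k"
    if B: "B \<in> letter_sets n k" and c: "c = N \<or> c = - N" for B c
  proof -
    have "\<bar>c\<bar> = N" using c by (auto simp: N_def)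
    moreover have "N \<notin> abs ` B" using letter_setsD(4)[OF B] by (force simp: N_def)
    moreover have "c \<notin> B" using calculation by force
    ultimately show ?thesis
      using B letter_setsD(1)[OF B] by (auto simp: letter_sets_def N_def)
  qed
  fix B assume "B \<in> insert N ` letter_sets n k \<union> insert (- N) ` letter_sets n k
      \<union> (if k = 0 then {} else letter_sets n (k - 1))"
  thus "B \<in> letter_sets (Suc n) k"
    using ins by (auto simp: letter_sets_def split: if_splits)
qed

text \<open>The new letter is too large to lie below a prefix letter or to take part in a negative
  sum.\<close>

lemma cross_len_insert_pos:
  assumes "B \<in> letter_sets n k"
  shows "cross_len (Suc n) (insert (int (Suc n)) B) = cross_len n B"
proof -
  let ?N = "int (Suc n)"
  note B = letter_setsD[OF assms]
  have nin: "?N \<notin> B" using B(4)[of ?N] by auto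
  have compl: "{1..int (Suc n)} - abs ` insert ?N B = {1..int n} - abs ` B" by auto
  have "{b \<in> B. ?N + b < 0} = {}" using B(4) by force
  hence "nsp (insert ?N B) = nsp B"
    using B(1) nin by (simp add: nsp_insert)
  moreover have "{b \<in> insert ?N B. b < a} = {b \<in> B. b < a}"
      "{b \<in> insert ?N B. a + b < 0} = {b \<in> B. a + b < 0}"
    if "a \<in> {1..int n} - abs ` B" for a
    using that by auto
  ultimately show ?thesis
    unfolding cross_len_def compl by simp
qed

text \<open>The new letter has a negative sum with itself and with each letter of \<open>B\<close>,
  and counts twice for each of the \<open>k\<close> prefix letters:
  \<open>1 + card B + 2 * k = Suc n + k\<close>, because \<open>card B + k = n\<close>.\<close>

lemma cross_len_insert_neg:
  assumes "B \<in> letter_sets n k"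
  shows "cross_len (Suc n) (insert (- int (Suc n)) B) = Suc n + k + cross_len n B"
proof -
  let ?N = "int (Suc n)"
  note B = letter_setsD[OF assms]
  have nin: "- ?N \<notin> B" using B(4)[of "- ?N"] by auto
  have compl: "{1..int (Suc n)} - abs ` insert (- ?N) B = {1..int n} - abs ` B" by auto
  have "{b \<in> B. - ?N + b < 0} = B" using B(4) by force
  hence "nsp (insert (- ?N) B) = 1 + card B + nsp B"
    using B(1) nin by (simp add: nsp_insert)
  moreover have "card {b \<in> insert (- ?N) B. b < a} + card {b \<in> insert (- ?N) B. a + b < 0}
      = 2 + (card {b \<in> B. b < a} + card {b \<in> B. a + b < 0})"
    if a: "a \<in> {1..int n} - abs ` B" for a
  proof -
    have "{b \<in> insert (- ?N) B. b < a} = insert (- ?N) {b \<in> B. b < a}"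
      "{b \<in> insert (- ?N) B. a + b < 0} = insert (- ?N) {b \<in> B. a + b < 0}"
      using a by auto
    thus ?thesis using B(1) nin by simp
  qed
  ultimately have "cross_len (Suc n) (insert (- ?N) B)
      = 1 + card B + nsp B + (\<Sum>a\<in>{1..int n} - abs ` B.
          2 + (card {b \<in> B. b < a} + card {b \<in> B. a + b < 0}))"
    unfolding cross_len_def compl by simp
  also have "\<dots> = Suc n + k + cross_len n B"
    unfolding sum.distrib cross_len_def using B(2,3) by simp
  finally show ?thesis .
qed

text \<open>The new prefix letter exceeds all of \<open>B\<close>, giving \<open>card B\<close>
  inversions and no negative sum.\<close>

lemma cross_len_Suc:
  assumes "B \<in> letter_sets n k"
  shows "cross_len (Suc n) B = card B + cross_len n B"
proof -
  let ?N = "int (Suc n)"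
  note B = letter_setsD[OF assms]
  have "?N \<notin> abs ` B" using B(4) by force
  hence "{1..int (Suc n)} - abs ` B = insert ?N ({1..int n} - abs ` B)" by auto
  moreover have "{b \<in> B. b < ?N} = B" using B(4) by force
  moreover have "card {b \<in> B. ?N + b < 0} = 0"
    by (rule card_eq_0_iff[THEN iffD2]) (use B(4) in force)
  ultimately show ?thesis by (simp add: cross_len_def)
qed

text \<open>A Pascal rule of type B. It is solved by the u-binomial coefficient of n over k times
  the product of 1 + Y u^j for k < j <= n.\<close>

lemma coset_sum_Suc:
  "coset_sum u Y (Suc n) k = (1 + Y * u ^ (Suc n + k)) * coset_sum u Y n k
    + (if k = 0 then 0 else u ^ (Suc n - k) * coset_sum u Y n (k - 1))"
proof -
  let ?N = "int (Suc n)"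
  let ?f = "\<lambda>B. u ^ cross_len (Suc n) B * Y ^ negs B"
  let ?L = "letter_sets n k" and ?L' = "if k = 0 then {} else letter_sets n (k - 1)"
  have nin: "?N \<notin> B" "- ?N \<notin> B" if "B \<in> letter_sets n j" for B j
    using letter_setsD(4)[OF that, of ?N] letter_setsD(4)[OF that, of "- ?N"] by auto
  have inj: "inj_on (insert ?N) ?L" "inj_on (insert (- ?N)) ?L"
    using nin by (meson inj_onI insert_ident)+
  have disj1: "insert ?N ` ?L \<inter> insert (- ?N) ` ?L = {}"
  proof -
    have False if "B \<in> ?L" "insert (- ?N) C = insert ?N B" for B C
    proof -
      have "- ?N \<in> insert ?N B" using that(2) by blast
      thus False using nin(2)[OF that(1)] by auto
    qed
    thus ?thesis by blast
  qed
  have disj2: "(insert ?N ` ?L \<union> insert (- ?N) ` ?L) \<inter> ?L' = {}"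
    using nin by (auto split: if_splits)
  have "coset_sum u Y (Suc n) k
      = sum ?f (insert ?N ` ?L) + sum ?f (insert (- ?N) ` ?L) + sum ?f ?L'"
    unfolding coset_sum_def letter_sets_Suc
    using disj1 disj2 by (simp add: sum.union_disjoint finite_letter_sets del: of_nat_Suc)
  also have "sum ?f (insert ?N ` ?L) = coset_sum u Y n k"
    unfolding coset_sum_def sum.reindex[OF inj(1)] comp_def
  proof (rule sum.cong)
    fix B assume B: "B \<in> ?L"
    have "negs (insert ?N B) = negs B"
      using letter_setsD(1)[OF B] nin[OF B] by (simp add: negs_insert)
    thus "?f (insert ?N B) = u ^ cross_len n B * Y ^ negs B"
      by (simp only: cross_len_insert_pos[OF B])
  qed simp
  also have "sum ?f (insert (- ?N) ` ?L) = Y * u ^ (Suc n + k) * coset_sum u Y n k"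
    unfolding coset_sum_def sum.reindex[OF inj(2)] comp_def sum_distrib_left
  proof (rule sum.cong)
    fix B assume B: "B \<in> ?L"
    have "negs (insert (- ?N) B) = Suc (negs B)"
      using letter_setsD(1)[OF B] nin[OF B] by (simp add: negs_insert)
    thus "?f (insert (- ?N) B) = Y * u ^ (Suc n + k) * (u ^ cross_len n B * Y ^ negs B)"
      by (simp only: cross_len_insert_neg[OF B] power_add power_Suc mult_ac)
  qed simp
  also have "sum ?f ?L' = (if k = 0 then 0 else u ^ (Suc n - k) * coset_sum u Y n (k - 1))"
  proof (cases "k = 0")
    case False
    have "sum ?f (letter_sets n (k - 1)) = u ^ (Suc n - k) * coset_sum u Y n (k - 1)"
      unfolding coset_sum_def sum_distrib_left
    proof (rule sum.cong)
      fix B assume B: "B \<in> letter_sets n (k - 1)"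
      have "card B = Suc n - k" using letter_setsD(2)[OF B] False by auto
      thus "?f B = u ^ (Suc n - k) * (u ^ cross_len n B * Y ^ negs B)"
        by (simp only: cross_len_Suc[OF B] power_add mult_ac)
    qed simp
    thus ?thesis using False by simp
  qed simp
  finally show ?thesis by (simp add: algebra_simps)
qed

lemma coset_sum_0: "coset_sum u Y 0 k = of_bool (k = 0)"
proof -
  have "letter_sets 0 k = (if k = 0 then {{}} else {})"
    by (auto simp: letter_sets_def)
  thus ?thesis by (simp add: coset_sum_def cross_len_def)
qed

text \<open>A positive prefix consists of the absolute values that \<open>B\<close> misses, and
  being increasing it is their sorted list. Having no inversions and no negative sums of its own, it
  adds only cross terms to the length.\<close>

lemma signed_word_split:
  assumes xs: "xs \<in> signed_words n" and k: "k \<le> n" and sorted: "sorted_wrt (<) (0 # take k xs)"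
  defines "B \<equiv> set (drop k xs)"
  shows "B \<in> letter_sets n k" "distinct (drop k xs)"
    "take k xs = sorted_list_of_set ({1..int n} - abs ` B)"
    "signed_len xs = cross_len n B + invs (drop k xs)" "negs (set xs) = negs B"
proof -
  let ?K = "set (take k xs)"
  have len: "length xs = n" and dist: "distinct (map abs xs)" and abs: "abs ` set xs = {1..int n}"
    using xs by (auto simp: signed_words_def)
  have split: "xs = take k xs @ drop k xs" by simp
  have pos: "a > 0" if "a \<in> ?K" for a using sorted that by simp
  hence absK: "abs ` ?K = ?K" by force
  have dist': "distinct (map abs (take k xs) @ map abs (drop k xs))"
    using dist by (simp flip: map_append)
  hence "abs ` ?K \<inter> abs ` B = {}"
    unfolding B_def by (simp only: distinct_append set_map)
  hence disj: "?K \<inter> abs ` B = {}" using absK by simp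
  hence disj': "?K \<inter> B = {}" using pos by force
  have Un: "set xs = ?K \<union> B"
    unfolding B_def by (simp flip: set_append)
  hence "?K \<union> abs ` B = {1..int n}"
    using abs absK by (simp add: image_Un)
  hence K: "{1..int n} - abs ` B = ?K" and sub: "abs ` B \<subseteq> {1..int n}"
    using disj by auto
  have inj: "inj_on abs B" and "distinct (drop k xs)"
    using dist' unfolding B_def by (auto simp: distinct_map)
  moreover from this have "card B = n - k"
    unfolding B_def using len by (simp add: distinct_card)
  ultimately show "B \<in> letter_sets n k" "distinct (drop k xs)"
    using sub k by (auto simp: letter_sets_def)
  show "take k xs = sorted_list_of_set ({1..int n} - abs ` B)"
    unfolding K using sorted by (simp add: sorted_list_of_set.idem_if_sorted_distinct strict_sorted_iff)
  have sK: "sorted (take k xs)" "distinct (take k xs)"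
    using sorted by (auto simp: strict_sorted_iff)
  have "invs xs = invs (drop k xs) + (\<Sum>a\<in>?K. card {b \<in> B. b < a})"
    using invs_append[of "take k xs" "drop k xs"] sK disj' invs_sorted[OF sK(1)]
    by (simp add: B_def)
  moreover have "nsp (set xs) = nsp B + (\<Sum>a\<in>?K. card {b \<in> B. a + b < 0})"
    unfolding Un by (rule nsp_Un_positive) (use pos disj' in \<open>auto simp: B_def\<close>)
  ultimately show "signed_len xs = cross_len n B + invs (drop k xs)"
    by (simp add: signed_len_def cross_len_def K sum.distrib)
  have "{b \<in> set xs. b < 0} = {b \<in> B. b < 0}"
    unfolding Un using pos by force
  thus "negs (set xs) = negs B" by (simp add: negs_def)
qed

lemma signed_word_join:
  assumes B: "B \<in> letter_sets n k" and ys: "ys \<in> permutations_of_set B"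
  defines "xs \<equiv> sorted_list_of_set ({1..int n} - abs ` B) @ ys"
  shows "xs \<in> signed_words n" "sorted_wrt (<) (0 # take k xs)" "drop k xs = ys"
proof -
  let ?K = "{1..int n} - abs ` B"
  have ys: "set ys = B" "distinct ys" using ys by (auto simp: permutations_of_set_def)
  have len: "length (sorted_list_of_set ?K) = k"
    using letter_setsD(3)[OF B] by simp
  show "drop k xs = ys" using len by (simp add: xs_def)
  have take: "take k xs = sorted_list_of_set ?K" using len by (simp add: xs_def)
  show "sorted_wrt (<) (0 # take k xs)"
    unfolding take by auto
  have inj: "inj_on abs B" "abs ` B \<subseteq> {1..int n}" using B by (auto simp: letter_sets_def)
  have "map abs (sorted_list_of_set ?K) = sorted_list_of_set ?K"
    by (intro map_idI) auto
  hence map: "map abs xs = sorted_list_of_set ?K @ map abs ys"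
    by (simp add: xs_def)
  have "distinct (map abs xs)"
    unfolding map using inj(1) ys by (auto simp: distinct_map)
  moreover have "abs ` set xs = {1..int n}"
  proof -
    have "abs ` set xs = set (map abs xs)" by simp
    also have "\<dots> = ?K \<union> abs ` B" unfolding map using ys by simp
    finally show ?thesis using inj(2) by blast
  qed
  moreover have "length xs = n"
    using len distinct_card[OF ys(2)] ys(1) letter_setsD(2)[OF B] by (simp add: xs_def)
  ultimately show "xs \<in> signed_words n"
    by (simp add: signed_words_def)
qed

text \<open>After expanding each word and exchanging the sums, the words with an admissible prefix
  of length \<open>k\<close> correspond to pairs of a letter set \<open>B\<close> and an arbitrary
  ordering of \<open>B\<close>; the orderings are summed by standardization.\<close>

lemma signed_sum_recursion:
  fixes x :: "nat \<Rightarrow> 'a::comm_ring_1"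
  assumes "x n = 1"
  shows "signed_sum u Y n x = (\<Sum>k\<le>n. x k * (\<Prod>i<k. 1 - x i) *
    (coset_sum u Y n k * signed_sum u 0 (n - k) (\<lambda>i. x (k + i))))"
proof -
  let ?c = "\<lambda>k. x k * (\<Prod>i<k. 1 - x i)"
  let ?w = "\<lambda>xs. u ^ signed_len xs * Y ^ negs (set xs)"
  let ?d = "\<lambda>k ys. desc_prod (\<lambda>i. x (k + i)) (hd ys) ys"
  let ?s = "\<lambda>k xs. sorted_wrt (<) (0 # take k xs)"
  have inner: "(\<Sum>xs\<in>{xs \<in> signed_words n. ?s k xs}. ?w xs * ?d k (drop k xs))
      = coset_sum u Y n k * perm_sum u (n - k) (\<lambda>i. x (k + i))" if k: "k \<le> n" for k
  proof -
    let ?L = "letter_sets n k"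
    have "(\<Sum>xs\<in>{xs \<in> signed_words n. ?s k xs}. ?w xs * ?d k (drop k xs))
      = (\<Sum>(B, ys)\<in>Sigma ?L permutations_of_set.
          u ^ cross_len n B * Y ^ negs B * (u ^ invs ys * ?d k ys))"
    proof (rule sum.reindex_bij_witness[where j = "\<lambda>xs. (set (drop k xs), drop k xs)" and
          i = "\<lambda>(B, ys). sorted_list_of_set ({1..int n} - abs ` B) @ ys"], goal_cases)
      case (1 xs)
      hence "take k xs = sorted_list_of_set ({1..int n} - abs ` set (drop k xs))"
        using signed_word_split(3)[of xs n k] k by blast
      thus ?case by (simp only: prod.case) (metis append_take_drop_id)
    next
      case (2 xs)
      thus ?case using signed_word_split(1,2)[of xs n k] k by (auto simp: permutations_of_set_def simp del: sorted_wrt.simps)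
    next
      case (3 p)
      then obtain B ys where p: "p = (B, ys)" "B \<in> ?L" "ys \<in> permutations_of_set B" by auto
      moreover have "set ys = B" using p(3) by (simp add: permutations_of_set_def)
      ultimately show ?case using signed_word_join(3)[OF p(2,3)] by simp
    next
      case (4 p)
      thus ?case using signed_word_join(1,2)[of _ n k] by (auto simp del: sorted_wrt.simps)
    next
      case (5 xs)
      thus ?case using signed_word_split(4,5)[of xs n k] k
        by (simp add: power_add mult_ac del: sorted_wrt.simps)
    qed
    also have "\<dots> = (\<Sum>B\<in>?L. u ^ cross_len n B * Y ^ negs B *
        (\<Sum>ys\<in>permutations_of_set B. u ^ invs ys * ?d k ys))"
      using letter_setsD(1) by (subst sum.Sigma[symmetric])
        (auto simp: finite_letter_sets sum_distrib_left)
    also have "\<dots> = (\<Sum>B\<in>?L. u ^ cross_len n B * Y ^ negs B * perm_sum u (n - k) (\<lambda>i. x (k + i)))"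
    proof (rule sum.cong)
      fix B assume B: "B \<in> ?L"
      have "card B = n - k" using letter_setsD(2)[OF B] by simp
      thus "u ^ cross_len n B * Y ^ negs B * (\<Sum>ys\<in>permutations_of_set B. u ^ invs ys * ?d k ys)
          = u ^ cross_len n B * Y ^ negs B * perm_sum u (n - k) (\<lambda>i. x (k + i))"
        by (simp add: perm_sum_eq[OF letter_setsD(1)[OF B]])
    qed simp
    finally show ?thesis by (simp add: coset_sum_def sum_distrib_right)
  qed
  have "desc_prod x 0 xs = (\<Sum>k\<le>n. of_bool (?s k xs) * (?c k * ?d k (drop k xs)))"
    if xs: "xs \<in> signed_words n" for xs
  proof -
    have "length xs = n" "distinct xs" using xs by (auto simp: signed_words_def distinct_map)
    moreover have "0 \<notin> set xs"
    proof
      assume "0 \<in> set xs"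
      hence "\<bar>0\<bar> \<in> abs ` set xs" by blast
      thus False using xs by (simp add: signed_words_def)
    qed
    ultimately show ?thesis
      using desc_prod_expansion[of 0 xs x] assms by simp
  qed
  hence "signed_sum u Y n x = (\<Sum>xs\<in>signed_words n. \<Sum>k\<le>n.
      ?c k * (of_bool (?s k xs) * (?w xs * ?d k (drop k xs))))"
    by (simp add: signed_sum_def sum_distrib_left mult_ac del: sorted_wrt.simps)
  also have "\<dots> = (\<Sum>k\<le>n. ?c k * (\<Sum>xs\<in>signed_words n. of_bool (?s k xs) * (?w xs * ?d k (drop k xs))))"
    by (subst sum.swap) (simp only: sum_distrib_left)
  also have "\<dots> = (\<Sum>k\<le>n. ?c k * (\<Sum>xs\<in>{xs \<in> signed_words n. ?s k xs}. ?w xs * ?d k (drop k xs)))"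
  proof -
    have "(\<Sum>xs\<in>signed_words n. of_bool (?s k xs) * (?w xs * ?d k (drop k xs)))
        = (\<Sum>xs\<in>{xs \<in> signed_words n. ?s k xs}. ?w xs * ?d k (drop k xs))" for k
      by (rule sum.mono_neutral_cong_right) (auto simp: finite_signed_words)
    thus ?thesis by (simp only:)
  qed
  also have "\<dots> = (\<Sum>k\<le>n. ?c k * (coset_sum u Y n k * signed_sum u 0 (n - k) (\<lambda>i. x (k + i))))"
    by (rule sum.cong) (simp_all only: inner atMost_iff signed_sum_0)
  finally show ?thesis .
qed

subsection \<open>Evaluation of the recursion\<close>

lemma coset_sum_eq_0: "n < k \<Longrightarrow> coset_sum u Y n k = 0"
  by (simp add: coset_sum_def letter_sets_def)

text \<open>The factor \<open>X ^ (k * (n - k))\<close> turns binomial coefficients in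
  \<open>inverse X\<close> into those in \<open>X\<close> and normalizes the Pascal rule, so that
  \<open>D n k\<close> enters \<open>D (Suc n) (Suc k)\<close> with coefficient 1.\<close>

lemma coset_sum_vandermonde:
  fixes X Y W :: "'a::field"
  assumes "X \<noteq> 0"
  shows "(\<Sum>k\<le>n. X ^ (k * (n - k)) * coset_sum (inverse X) Y n k *
      (W ^ (n - k) * (\<Prod>i<k. 1 - X ^ i * W)))
    = (\<Prod>j<n. 1 + inverse X ^ Suc j * Y * W)"
proof (induction n)
  case 0
  show ?case by (simp add: coset_sum_0)
next
  case (Suc n)
  let ?u = "inverse X"
  define D where "D n k = X ^ (k * (n - k)) * coset_sum ?u Y n k" for n k
  define P where "P k = (\<Prod>i<k. 1 - X ^ i * W)" for k
  have cancel: "X ^ (a + b) * ?u ^ b = X ^ a" for a b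
    using assms by (simp add: power_add field_simps)
  have D0: "D (Suc n) 0 = (X ^ 0 + Y * ?u ^ Suc n) * D n 0"
    by (simp add: D_def coset_sum_Suc)
  have DSuc: "D (Suc n) (Suc k) = (X ^ Suc k + Y * ?u ^ Suc n) * D n (Suc k) + D n k"
    if "k \<le> n" for k
  proof -
    have "X ^ (Suc k * (n - k)) * ?u ^ (n - k) = X ^ (k * (n - k))"
      using cancel[of "k * (n - k)" "n - k"] by (simp add: add.commute)
    moreover have "X ^ (Suc k * (n - k)) * (1 + Y * ?u ^ (Suc n + Suc k)) * coset_sum ?u Y n (Suc k)
        = (X ^ Suc k + Y * ?u ^ Suc n) * D n (Suc k)"
    \<comment> \<open>At \<open>k = n\<close> the subtraction \<open>n - Suc k\<close> truncates,
      but then both sides vanish by \<open>coset_sum_eq_0\<close>.\<close>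
    proof (cases "k = n")
      case False
      hence "Suc k * (n - k) = Suc k * (n - Suc k) + Suc k"
        using that by (metis Suc_diff_Suc le_neq_implies_less mult_Suc_right add.commute)
      hence "X ^ (Suc k * (n - k)) = X ^ (Suc k * (n - Suc k)) * X ^ Suc k"
        by (simp only: power_add)
      moreover have "X ^ Suc k * (1 + Y * ?u ^ (Suc n + Suc k)) = X ^ Suc k + Y * ?u ^ Suc n"
        using assms by (simp add: power_add field_simps)
      moreover have "a * b * c * d = (b * c) * (a * d)" for a b c d :: 'a
        by (simp only: mult_ac)
      ultimately show ?thesis unfolding D_def by (simp only:)
    qed (simp add: D_def coset_sum_eq_0)
    moreover have "D (Suc n) (Suc k)
        = X ^ (Suc k * (n - k)) * (1 + Y * ?u ^ (Suc n + Suc k)) * coset_sum ?u Y n (Suc k)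
          + X ^ (Suc k * (n - k)) * ?u ^ (n - k) * coset_sum ?u Y n k"
      unfolding D_def coset_sum_Suc[of ?u Y n "Suc k"]
      by (simp add: distrib_left mult.assoc del: power_Suc mult_Suc add_Suc add_Suc_right)
    ultimately show ?thesis by (simp only: D_def)
  qed
  have "(\<Sum>k\<le>Suc n. D (Suc n) k * (W ^ (Suc n - k) * P k))
      = (\<Sum>k\<le>Suc n. (X ^ k + Y * ?u ^ Suc n) * D n k * (W ^ (Suc n - k) * P k))
        + (\<Sum>k\<le>n. D n k * (W ^ (n - k) * P (Suc k)))"
    unfolding sum.atMost_Suc_shift D0
    by (simp add: DSuc distrib_right sum.distrib del: power_Suc)
  also have "\<dots> = (\<Sum>k\<le>n. (X ^ k + Y * ?u ^ Suc n) * D n k * (W ^ (Suc n - k) * P k))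
        + (\<Sum>k\<le>n. D n k * (W ^ (n - k) * P (Suc k)))"
    by (simp add: D_def coset_sum_eq_0)
  also have "\<dots> = (\<Sum>k\<le>n. (1 + ?u ^ Suc n * Y * W) * (D n k * (W ^ (n - k) * P k)))"
    unfolding sum.distrib[symmetric]
  proof (rule sum.cong)
    fix k assume "k \<in> {..n}"
    hence W: "W ^ (Suc n - k) = W * W ^ (n - k)" by (simp add: Suc_diff_le)
    have P: "P (Suc k) = P k * (1 - X ^ k * W)" by (simp add: P_def)
    \<comment> \<open>Here \<open>(X ^ k + Y * ?u ^ Suc n) * W + (1 - X ^ k * W)\<close> loses its
      dependence on \<open>k\<close>, so the whole sum gains one factor of the product.\<close>
    show "(X ^ k + Y * ?u ^ Suc n) * D n k * (W ^ (Suc n - k) * P k)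
        + D n k * (W ^ (n - k) * P (Suc k))
        = (1 + ?u ^ Suc n * Y * W) * (D n k * (W ^ (n - k) * P k))"
      unfolding W P by (simp add: algebra_simps del: power_Suc)
  qed simp
  also have "\<dots> = (\<Prod>j<Suc n. 1 + ?u ^ Suc j * Y * W)"
    using Suc.IH unfolding sum_distrib_left[symmetric] D_def P_def by (simp add: mult.commute)
  finally show ?case unfolding D_def P_def .
qed

section \<open>The weights x_i and the product side\<close>

definition desc_weight :: "'a::field \<Rightarrow> 'a \<Rightarrow> nat \<Rightarrow> nat \<Rightarrow> 'a" where
  "desc_weight X Z n i = X ^ (n\<^sup>2 - i\<^sup>2) * Z ^ (n - i)"

lemma power_mult_shift:
  fixes X Z :: "'a::comm_monoid_mult"
  shows "X ^ a * (X ^ (2 * k) * Z) ^ b = X ^ (a + 2 * k * b) * Z ^ b"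
  by (simp add: power_mult_distrib power_add mult.assoc flip: power_mult)

text \<open>With j = n-k-i one has n^2 - (k+i)^2 = (n-k)^2 - i^2 + 2kj, and the surplus 2kj is
  absorbed by the j-th power of X^{2k} Z.\<close>

lemma desc_weight_shift:
  assumes "k \<le> n"
  shows "desc_weight X Z n (k + i) = desc_weight X (X ^ (2 * k) * Z) (n - k) i"
proof (cases "k + i \<le> n")
  case True
  then obtain j where n: "n = k + i + j" using le_Suc_ex by blast
  have "n\<^sup>2 - (k + i)\<^sup>2 = j * (2 * k + 2 * i + j)" "(n - k)\<^sup>2 - i\<^sup>2 = j * (2 * i + j)"
    unfolding n by (simp_all add: power2_eq_square algebra_simps)
  moreover have "j * (2 * k + 2 * i + j) = j * (2 * i + j) + 2 * k * j"
    by (simp add: algebra_simps)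
  moreover have "n - (k + i) = j" "n - k - i = j" using n by auto
  ultimately show ?thesis
    by (simp only: desc_weight_def power_mult_shift)
next
  \<comment> \<open>Past \<open>n\<close> the truncated subtractions make both weights 1, so the two
    weight families agree as functions on all naturals.\<close>
  case False
  hence "n\<^sup>2 \<le> (k + i)\<^sup>2" "(n - k)\<^sup>2 \<le> i\<^sup>2" by (auto intro: power_mono)
  thus ?thesis using False by (simp add: desc_weight_def)
qed

text \<open>Splitting n^2 - k^2 as k(n-k) + n(n-k) exposes the factor required by
  \<open>coset_sum_vandermonde\<close>, with \<open>W = X ^ n * Z\<close>.\<close>

lemma desc_weight_eq:
  assumes "k \<le> n"
  shows "desc_weight X Z n k = X ^ (k * (n - k)) * (X ^ n * Z) ^ (n - k)"
proof -
  obtain j where n: "n = k + j" using assms le_Suc_ex by blast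
  have "n\<^sup>2 - k\<^sup>2 = k * (n - k) + n * (n - k)"
    unfolding n by (simp add: power2_eq_square algebra_simps)
  thus ?thesis
    by (simp add: desc_weight_def power_add power_mult_distrib power_mult mult_ac)
qed

text \<open>The value of the theorem's right-hand side at Y = 0, as x_i = (X^{n+i} Z)^{n-i}.\<close>

definition desc_quot :: "'a::field \<Rightarrow> 'a \<Rightarrow> nat \<Rightarrow> 'a" where
  "desc_quot X Z n = (\<Prod>i<n. (1 - desc_weight X Z n i) / (1 - X ^ (n + i) * Z))"

text \<open>Since (n-k+i) + 2k = n + (k+i), the substitution moves factor \<open>i\<close> for
  \<open>n - k\<close> to factor \<open>k + i\<close> for \<open>n\<close>, which gives a tail of
  the same product.\<close>

lemma desc_quot_shift:
  assumes "k \<le> n"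
  shows "desc_quot X (X ^ (2 * k) * Z) (n - k)
    = (\<Prod>i=k..<n. (1 - desc_weight X Z n i) / (1 - X ^ (n + i) * Z))"
proof -
  have "(\<Prod>i=k..<n. (1 - desc_weight X Z n i) / (1 - X ^ (n + i) * Z))
      = (\<Prod>i<n - k. (1 - desc_weight X Z n (k + i)) / (1 - X ^ (n + (k + i)) * Z))"
    using prod.atLeastLessThan_shift_0[of _ k n] by (simp add: comp_def lessThan_atLeast0)
  also have "\<dots> = desc_quot X (X ^ (2 * k) * Z) (n - k)"
    unfolding desc_quot_def
  proof (rule prod.cong)
    fix i assume "i \<in> {..<n - k}"
    have "n + (k + i) = (n - k + i) + 2 * k" using assms by simp
    hence "X ^ (n + (k + i)) * Z = X ^ (n - k + i) * (X ^ (2 * k) * Z)"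
      by (simp only: power_add mult.assoc)
    thus "(1 - desc_weight X Z n (k + i)) / (1 - X ^ (n + (k + i)) * Z)
        = (1 - desc_weight X (X ^ (2 * k) * Z) (n - k) i) / (1 - X ^ (n - k + i) * (X ^ (2 * k) * Z))"
      by (simp only: desc_weight_shift[OF assms])
  qed simp
  finally show ?thesis ..
qed

text \<open>The factors \<open>1 - desc_weight X Z n i\<close> with \<open>i < k\<close> complete
  the tail to the full quotient, up to the first \<open>k\<close> denominators. These are the
  factors \<open>1 - X ^ i * W\<close> of \<open>coset_sum_vandermonde\<close> at
  \<open>W = X ^ n * Z\<close>.\<close>

lemma desc_quot_recursion:
  fixes X Y Z :: "'a::field"
  assumes "X \<noteq> 0" and "\<And>a. X ^ a * Z \<noteq> 1"
  shows "(\<Sum>k\<le>n. desc_weight X Z n k * (\<Prod>i<k. 1 - desc_weight X Z n i) *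
      (coset_sum (inverse X) Y n k * desc_quot X (X ^ (2 * k) * Z) (n - k)))
    = (\<Prod>i<n. 1 + X ^ i * Y * Z) * desc_quot X Z n"
proof -
  let ?w = "\<lambda>i. 1 - desc_weight X Z n i" and ?q = "\<lambda>i. 1 - X ^ (n + i) * Z"
  have split: "(\<Prod>i<n. f i) = (\<Prod>i<k. f i) * (\<Prod>i=k..<n. f i)" if "k \<le> n"
    for k and f :: "nat \<Rightarrow> 'a"
    using prod.atLeastLessThan_concat[of 0 k n f] that by (simp add: lessThan_atLeast0)
  have "(\<Sum>k\<le>n. desc_weight X Z n k * (\<Prod>i<k. ?w i) *
      (coset_sum (inverse X) Y n k * desc_quot X (X ^ (2 * k) * Z) (n - k)))
    = (\<Sum>k\<le>n. desc_quot X Z n * (X ^ (k * (n - k)) * coset_sum (inverse X) Y n k *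
      ((X ^ n * Z) ^ (n - k) * (\<Prod>i<k. 1 - X ^ i * (X ^ n * Z)))))"
  proof (rule sum.cong)
    fix k assume "k \<in> {..n}"
    hence k: "k \<le> n" by simp
    have comm: "a * b * c * (d * e) = a * d * b * (c * e)" for a b c d e :: 'a
      by (simp only: mult_ac)
    have "?q i \<noteq> 0" for i using assms(2)[of "n + i"] by auto
    hence nz: "(\<Prod>i<k. ?q i) \<noteq> 0" by simp
    have "desc_quot X Z n = (\<Prod>i<k. ?w i / ?q i) * desc_quot X (X ^ (2 * k) * Z) (n - k)"
      unfolding desc_quot_shift[OF k] unfolding desc_quot_def by (rule split[OF k])
    hence "(\<Prod>i<k. ?w i) * desc_quot X (X ^ (2 * k) * Z) (n - k)
        = desc_quot X Z n * (\<Prod>i<k. ?q i)"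
      using nz by (simp add: prod_dividef)
    moreover have "(\<Prod>i<k. ?q i) = (\<Prod>i<k. 1 - X ^ i * (X ^ n * Z))"
      by (simp add: power_add mult_ac)
    ultimately show "desc_weight X Z n k * (\<Prod>i<k. ?w i) *
        (coset_sum (inverse X) Y n k * desc_quot X (X ^ (2 * k) * Z) (n - k))
      = desc_quot X Z n * (X ^ (k * (n - k)) * coset_sum (inverse X) Y n k *
        ((X ^ n * Z) ^ (n - k) * (\<Prod>i<k. 1 - X ^ i * (X ^ n * Z))))"
      unfolding desc_weight_eq[OF k] comm by (simp only: mult_ac)
  qed simp
  also have "\<dots> = desc_quot X Z n * (\<Prod>j<n. 1 + inverse X ^ Suc j * Y * (X ^ n * Z))"
    unfolding sum_distrib_left[symmetric] coset_sum_vandermonde[OF assms(1)] ..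
  also have "(\<Prod>j<n. 1 + inverse X ^ Suc j * Y * (X ^ n * Z))
      = (\<Prod>j<n. 1 + X ^ (n - Suc j) * Y * Z)"
  proof (rule prod.cong)
    fix j assume "j \<in> {..<n}"
    hence "X ^ n = X ^ (n - Suc j) * X ^ Suc j"
      by (metis Suc_leI le_add_diff_inverse2 lessThan_iff power_add)
    hence cancel: "inverse X ^ Suc j * X ^ n = X ^ (n - Suc j)"
      using assms(1) by (simp add: field_simps)
    have "inverse X ^ Suc j * Y * (X ^ n * Z) = (inverse X ^ Suc j * X ^ n) * Y * Z"
      by (simp only: mult_ac)
    thus "1 + inverse X ^ Suc j * Y * (X ^ n * Z) = 1 + X ^ (n - Suc j) * Y * Z"
      by (simp only: cancel)
  qed simp
  also have "\<dots> = (\<Prod>i<n. 1 + X ^ i * Y * Z)"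
    by (rule prod.nat_diff_reindex)
  finally show ?thesis by (simp add: mult.commute)
qed

lemma signed_sum_desc_weight_recursion:
  "signed_sum u Y n (desc_weight X Z n)
    = (\<Sum>k\<le>n. desc_weight X Z n k * (\<Prod>i<k. 1 - desc_weight X Z n i) *
      (coset_sum u Y n k * signed_sum u 0 (n - k) (desc_weight X (X ^ (2 * k) * Z) (n - k))))"
proof -
  have "(\<lambda>i. desc_weight X Z n (k + i)) = desc_weight X (X ^ (2 * k) * Z) (n - k)"
    if "k \<le> n" for k
    using desc_weight_shift[OF that] by auto
  moreover have "desc_weight X Z n n = 1" by (simp add: desc_weight_def)
  ultimately show ?thesis
    by (subst signed_sum_recursion) (auto intro!: sum.cong)
qed

text \<open>Both sides satisfy one recursion, hence so does their difference. The assumption is used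
  with \<open>b = 1\<close> for the denominators and with \<open>b = n\<close> for the coefficient
  of the unknown term.\<close>

lemma signed_sum_positive:
  fixes X Z :: "'a::field"
  assumes "X \<noteq> 0" and "\<And>a b. 0 < b \<Longrightarrow> X ^ a * Z ^ b \<noteq> 1"
  shows "signed_sum (inverse X) 0 n (desc_weight X Z n) = desc_quot X Z n"
  using assms(2)
proof (induction n arbitrary: Z rule: less_induct)
  case (less n)
  let ?S = "\<lambda>k. signed_sum (inverse X) 0 (n - k) (desc_weight X (X ^ (2 * k) * Z) (n - k))"
  let ?Q = "\<lambda>k. desc_quot X (X ^ (2 * k) * Z) (n - k)"
  let ?c = "\<lambda>k. desc_weight X Z n k * (\<Prod>i<k. 1 - desc_weight X Z n i)"
  show ?case
  proof (cases "n = 0")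
    case True
    have "signed_words 0 = {[]}" by (auto simp: signed_words_def)
    thus ?thesis
      using True by (simp add: signed_sum_def desc_quot_def signed_len_def)
  next
    case False
    have IH: "?S k = ?Q k" if "0 < k" "k \<le> n" for k
    proof (rule less.IH)
      fix a b :: nat assume "0 < b"
      show "X ^ a * (X ^ (2 * k) * Z) ^ b \<noteq> 1"
        unfolding power_mult_shift by (rule less.prems[OF \<open>0 < b\<close>])
    qed (use that in auto)
    have head: "coset_sum (inverse X) 0 m 0 = 1" for m
      by (induction m) (simp_all add: coset_sum_0 coset_sum_Suc)
    have S: "?S 0 = (\<Sum>k\<le>n. ?c k * (coset_sum (inverse X) 0 n k * ?S k))"
      using signed_sum_desc_weight_recursion[of "inverse X" 0 n X Z] by simp
    have Q: "?Q 0 = (\<Sum>k\<le>n. ?c k * (coset_sum (inverse X) 0 n k * ?Q k))"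
      using desc_quot_recursion[OF assms(1), of Z n 0] less.prems[of 1] by simp
    \<comment> \<open>The induction hypothesis kills every term with \<open>k > 0\<close>, and
      \<open>head\<close> gives the term \<open>k = 0\<close> the coefficient x_0.\<close>
    have "?S 0 - ?Q 0 = (\<Sum>k\<le>n. ?c k * (coset_sum (inverse X) 0 n k * (?S k - ?Q k)))"
      by (subst S, subst Q) (simp only: right_diff_distrib sum_subtractf)
    also have "\<dots> = desc_weight X Z n 0 * (?S 0 - ?Q 0)"
      by (subst sum.remove[of _ 0]) (auto simp: head IH)
    finally have "(1 - desc_weight X Z n 0) * (?S 0 - ?Q 0) = 0"
      by (simp add: algebra_simps)
    moreover have "1 - desc_weight X Z n 0 \<noteq> 0"
      using less.prems[of n] False by (auto simp: desc_weight_def)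
    ultimately show ?thesis by simp
  qed
qed

lemma signed_sum_desc_weight:
  fixes X Y Z :: "'a::field"
  assumes "X \<noteq> 0" and "\<And>a b. 0 < b \<Longrightarrow> X ^ a * Z ^ b \<noteq> 1"
  shows "signed_sum (inverse X) Y n (desc_weight X Z n)
    = (\<Prod>i<n. 1 + X ^ i * Y * Z) * desc_quot X Z n"
proof -
  have "signed_sum (inverse X) 0 (n - k) (desc_weight X (X ^ (2 * k) * Z) (n - k))
      = desc_quot X (X ^ (2 * k) * Z) (n - k)" for k
  proof (rule signed_sum_positive[OF assms(1)])
    fix a b :: nat assume "0 < b"
    show "X ^ a * (X ^ (2 * k) * Z) ^ b \<noteq> 1"
      unfolding power_mult_shift by (rule assms(2)[OF \<open>0 < b\<close>])
  qed
  moreover have "X ^ a * Z \<noteq> 1" for a using assms(2)[of 1 a] by simp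
  ultimately show ?thesis
    by (subst signed_sum_desc_weight_recursion)
       (simp only: desc_quot_recursion[OF assms(1)] not_False_eq_True)
qed

section \<open>Return to B_n and to the indeterminates\<close>

lemma hyperoctahedral_sum_eq_signed_sum:
  fixes X Y Z :: "'a::field"
  assumes "X \<noteq> 0"
  shows "(\<Sum>w\<in>hyperoctahedral n.
      X powi (int (sigma_stat n w) - int (cox_length n w)) * Y ^ neg n w * Z ^ rmaj n w)
    = signed_sum (inverse X) Y n (desc_weight X Z n)"
  unfolding signed_sum_def sum.reindex_bij_betw[OF window_bij, symmetric]
proof (rule sum.cong)
  fix w assume w: "w \<in> hyperoctahedral n"
  have "{b \<in> set (window n w). b < 0} = w ` {i \<in> {1..int n}. w i < 0}"
    by (auto simp: set_window)
  hence neg: "negs (set (window n w)) = neg n w"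
    using hyperoctahedralD(3)[OF w]
    by (simp add: negs_def neg_def card_image inj_on_subset)
  \<comment> \<open>The preceding letter 0 plays the part of \<open>w 0\<close> and shifts the word,
    so that index \<open>i\<close> holds \<open>w i\<close>.\<close>
  have "(0 # window n w) ! i = w (int i)" if "i < n" for i
    using that hyperoctahedralD(4)[OF w] by (cases i) (auto simp: add.commute)
  hence "desc_prod (desc_weight X Z n) 0 (window n w)
      = (\<Prod>i<n. if w (int i + 1) < w (int i) then desc_weight X Z n i else 1)"
    unfolding desc_prod_eq by simp
  also have "\<dots> = (\<Prod>i\<in>descents n w. desc_weight X Z n i)"
    unfolding descents_eq[OF w] by (rule prod.inter_filter[symmetric, of "{..<n}", simplified])
  also have "\<dots> = X ^ sigma_stat n w * Z ^ rmaj n w"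
    by (simp add: desc_weight_def prod.distrib sigma_stat_def rmaj_def power_sum)
  finally show "X powi (int (sigma_stat n w) - int (cox_length n w)) * Y ^ neg n w * Z ^ rmaj n w
      = inverse X ^ signed_len (window n w) * Y ^ negs (set (window n w)) *
        desc_prod (desc_weight X Z n) 0 (window n w)"
    using assms
    by (simp add: neg cox_length_eq_signed_len[OF w] power_int_diff divide_inverse
        power_inverse mult_ac)
qed simp

lemma to_fract_power: "to_fract (x ^ n) = to_fract x ^ n"
  by (induction n) simp_all

theorem proposition1p7:
  fixes n :: nat
  shows "(\<Sum>w\<in>hyperoctahedral n.
            indet_X powi (int (sigma_stat n w) - int (cox_length n w))
            * indet_Y ^ neg n w * indet_Z ^ rmaj n w)
       = (\<Prod>i<n. (1 + indet_X ^ i * indet_Y * indet_Z)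
                    * (1 - (indet_X ^ (n + i) * indet_Z) ^ (n - i))
                    / (1 - indet_X ^ (n + i) * indet_Z))"
proof -
  have X: "indet_X \<noteq> 0"
    by (simp add: indet_X_def)
  have XZ: "indet_X ^ a * indet_Z ^ b \<noteq> 1" if "0 < b" for a b
  proof
    let ?p = "[:[:[:0, 1:]:]:] ^ a * [:0, 1:] ^ b :: int poly poly poly"
    assume "indet_X ^ a * indet_Z ^ b = 1"
    hence "to_fract ?p = to_fract 1"
      by (simp add: indet_X_def indet_Z_def to_fract_power)
    \<comment> \<open>Evaluating the outermost variable Z at 0 annihilates the left side, as
      \<open>b > 0\<close>, and leaves 1 on the right.\<close>
    hence "poly ?p 0 = poly 1 0"
      by (simp only: to_fract_eq_iff)
    thus False using that by (simp add: power_0_left)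
  qed
  have "desc_weight indet_X indet_Z n i = (indet_X ^ (n + i) * indet_Z) ^ (n - i)" if i: "i < n" for i
  proof -
    obtain j where n: "n = i + j" using le_Suc_ex[OF less_imp_le[OF i]] by blast
    have "n\<^sup>2 - i\<^sup>2 = (n + i) * (n - i)"
      unfolding n by (simp add: power2_eq_square algebra_simps)
    thus ?thesis by (simp add: desc_weight_def power_mult power_mult_distrib)
  qed
  moreover have "signed_sum (inverse indet_X) indet_Y n (desc_weight indet_X indet_Z n)
      = (\<Prod>i<n. 1 + indet_X ^ i * indet_Y * indet_Z) * desc_quot indet_X indet_Z n"
    using X XZ by (rule signed_sum_desc_weight)
  ultimately show ?thesis
    unfolding hyperoctahedral_sum_eq_signed_sum[OF X]
    by (simp add: desc_quot_def flip: prod.distrib)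
qed

end
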